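(* Suppose that for every $i\in[m]$ the function $f_i$ is gradient Lipschitz continuous with constant $r_i>0$, and let $\{(\mathbf{y}^k,X^k,\Pi^k)\}$ be the sequence generated by the ICEADMM algorithm with $H_i=\Theta_i$ and $\sigma_i>3\sqrt2\,w_ir_i$ for every $i\in[m]$. Then for every integer $k\ge1$, $$\min_{j=1,2,\dots,k}\max\{\|\nabla F(X^{j+k_0})\|^2,\|\nabla f(\mathbf{y}^{j+k_0})\|^2\}\le\frac{\varrho k_0}{k}(\varphi^1-f^* ),$$ where $\varrho:=\max_{i\in[m]}\frac{12m\sigma_i^2}{\vartheta_i}$ and $\vartheta_i:=\sigma_i-\frac{18w_i^2r_i^2}{\sigma_i}$.
   Context: Setting. $m,n\ge 1$ are integers, $[m]=\{1,\dots,m\}$, $w_1,\dots,w_m>0$ with $\sum_i w_i=1$, and each $f_i:\mathbb{R}^n\to\mathbb{R}$ is bounded from below. $f(\mathbf{x}):=\sum_{i=1}^m w_if_i(\mathbf{x})$, and $f^*:=f(\mathbf{x}^* )>-\infty$, where $\mathbf{x}^*$ is a minimizer of $f$ over $\mathbb{R}^n$. A function $g$ is gradient Lipschitz continuous with constant $r$ if it is differentiable and $\|\nabla g(\mathbf{x})-\nabla g(\mathbf{z})\|\le r\|\mathbf{x}-\mathbf{z}\|$ for all $\mathbf{x},\mathbf{z}$ (Euclidean norm). $\Theta_i$ is a symmetric $n\times n$ matrix with $r_iI\succeq\Theta_i\succeq0$ such that $f_i(\mathbf{x})\le f_i(\mathbf{z})+\langle\nabla f_i(\mathbf{z}),\mathbf{x}-\mathbf{z}\rangle+\frac12\langle\Theta_i(\mathbf{x}-\mathbf{z}),\mathbf{x}-\mathbf{z}\rangle$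 for all $\mathbf{x},\mathbf{z}\in\mathbb{R}^n$ (such a matrix exists, e.g. $\Theta_i=r_iI$). ICEADMM algorithm. Parameters $\sigma_i>0$, symmetric $H_i\succeq0$ ($i\in[m]$), $\sigma:=\sum_i\sigma_i$, an integer $k_0>0$, initial points $\mathbf{x}_i^0,\boldsymbol{\pi}_i^0\in\mathbb{R}^n$ ($i\in[m]$). Put $\mathcal{K}=\{0,k_0,2k_0,\dots\}$ and $\tau_k=\lfloor k/k_0\rfloor k_0$. For $k=0,1,2,\dots$: if $k\in\mathcal{K}$, set $\mathbf{x}^{k+1}=\sum_{i=1}^m\frac{\sigma_i}{\sigma}\mathbf{x}_i^k+\frac1\sigma\sum_{i=1}^m\boldsymbol{\pi}_i^k$. Then, with $\mathbf{y}^{k+1}:=\mathbf{x}^{\tau_k+1}$, for each $i\in[m]$ set $\mathbf{x}_i^{k+1}=\mathbf{x}_i^k-(w_iH_i+\sigma_iI)^{-1}\big[\sigma_i(\mathbf{x}_i^k-\mathbf{y}^{k+1})+w_i\nabla f_i(\mathbf{x}_i^k)+\boldsymbol{\pi}_i^k\big]$ and $\boldsymbol{\pi}_i^{k+1}=\boldsymbol{\pi}_i^k+\sigma_i(\mathbf{x}_i^{k+1}-\mathbf{y}^{k+1})$. Write $X^k=(\mathbf{x}_1^k,\dots,\mathbf{x}_m^k)$, $\Pi^k=(\boldsymbol{\pi}_1^k,\dots,\boldsymbol{\pi}_m^k)$. Notation. For $k\ge1$, $\mathcal{L}^k:=\sum_{i=1}^m\big(w_if_i(\mathbf{x}_i^k)+\langle\mathbf{x}_i^k-\mathbf{y}^k,\boldsymbol{\pi}_i^k\rangle+\frac{\sigma_i}{2}\|\mathbf{x}_i^k-\mathbf{y}^k\|^2\big)$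 and $\varphi^k:=\mathcal{L}^k+\sum_{i=1}^m\frac{6w_i^2r_i^2}{\sigma_i}\|\mathbf{x}_i^k-\mathbf{x}_i^{k-1}\|^2$. $F(X):=\sum_{i=1}^m w_if_i(\mathbf{x}_i)$, and the symbol $\nabla F(X)$ denotes the vector $\sum_{i=1}^m w_i\nabla f_i(\mathbf{x}_i)\in\mathbb{R}^n$ (not the full gradient in all blocks). *)

theory Defs
  imports "HOL-Analysis.Analysis"
begin

text \<open>
  The index set \<open>[m]\<close> is a finite type \<open>'m\<close> and \<open>\<real>\<^sup>n\<close> is \<open>real ^ 'n\<close>, so that
  \<open>m = CARD('m) \<ge> 1\<close> and \<open>n = CARD('n) \<ge> 1\<close> are arbitrary. A block vector
  \<open>X = (x\<^sub>1, \<dots>, x\<^sub>m)\<close> is a function \<open>'m \<Rightarrow> real ^ 'n\<close>; \<open>P\<close> stands for the block of multipliers \<open>\<pi>\<^sub>i\<close>.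
\<close>

subsection \<open>Gradients and the semidefinite order\<close>

definition grad :: "('a::real_inner \<Rightarrow> real) \<Rightarrow> 'a \<Rightarrow> 'a" where
  "grad g x = (THE D. GDERIV g x :> D)"

definition gradient_lipschitz :: "real \<Rightarrow> ('a::real_inner \<Rightarrow> real) \<Rightarrow> bool" where
  "gradient_lipschitz r g \<longleftrightarrow>
     (\<forall>x. g differentiable at x) \<and>
     (\<forall>x z. norm (grad g x - grad g z) \<le> r * norm (x - z))"

definition psd :: "real ^ 'n ^ 'n \<Rightarrow> bool" where
  "psd A \<longleftrightarrow> transpose A = A \<and> (\<forall>x. 0 \<le> (A *v x) \<bullet> x)"

definition loewner_le :: "real ^ 'n ^ 'n \<Rightarrow> real ^ 'n ^ 'n \<Rightarrow> bool" where
  "loewner_le A B \<longleftrightarrow> psd (B - A)"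

text \<open>The matrices \<open>\<Theta>\<close> admissible for a function \<open>g\<close> with gradient Lipschitz constant \<open>r\<close>.\<close>

definition upper_curvature_matrix :: "real \<Rightarrow> (real ^ 'n \<Rightarrow> real) \<Rightarrow> real ^ 'n ^ 'n \<Rightarrow> bool" where
  "upper_curvature_matrix r g \<Theta> \<longleftrightarrow>
     transpose \<Theta> = \<Theta> \<and> loewner_le 0 \<Theta> \<and> loewner_le \<Theta> (r *\<^sub>R mat 1) \<and>
     (\<forall>x z. g x \<le> g z + grad g z \<bullet> (x - z) + 1 / 2 * ((\<Theta> *v (x - z)) \<bullet> (x - z)))"

subsection \<open>The objective\<close>

definition objective ::
  "('m::finite \<Rightarrow> real) \<Rightarrow> ('m \<Rightarrow> real ^ 'n \<Rightarrow> real) \<Rightarrow> real ^ 'n \<Rightarrow> real" where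
  "objective w f x = (\<Sum>i\<in>UNIV. w i * f i x)"

text \<open>
  What is written \<open>\<nabla>F(X)\<close> is the vector in \<open>\<real>\<^sup>n\<close> below, not the gradient of
  \<open>F(X) = \<Sum>\<^sub>i w\<^sub>i f\<^sub>i(x\<^sub>i)\<close> with respect to all blocks.
\<close>

definition gradF ::
  "('m::finite \<Rightarrow> real) \<Rightarrow> ('m \<Rightarrow> real ^ 'n \<Rightarrow> real) \<Rightarrow> ('m \<Rightarrow> real ^ 'n) \<Rightarrow> real ^ 'n" where
  "gradF w f X = (\<Sum>i\<in>UNIV. w i *\<^sub>R grad (f i) (X i))"

subsection \<open>The ICEADMM algorithm\<close>

definition tau :: "nat \<Rightarrow> nat \<Rightarrow> nat" where
  "tau k0 k = (k div k0) * k0"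

text \<open>
  \<open>iceadmm w f \<sigma> H k0 x y X P\<close>: the sequences are generated by the algorithm from the arbitrary
  initial points \<open>X 0\<close> and \<open>P 0\<close>. The value \<open>x (k + 1)\<close> is prescribed only when \<open>k\<close> is a
  multiple of \<open>k0\<close>; the remaining values of \<open>x\<close>, and \<open>y 0\<close>, play no role.
\<close>

definition iceadmm ::
  "('m::finite \<Rightarrow> real) \<Rightarrow> ('m \<Rightarrow> real ^ 'n \<Rightarrow> real) \<Rightarrow> ('m \<Rightarrow> real) \<Rightarrow> ('m \<Rightarrow> real ^ 'n ^ 'n) \<Rightarrow>
   nat \<Rightarrow> (nat \<Rightarrow> real ^ 'n) \<Rightarrow> (nat \<Rightarrow> real ^ 'n) \<Rightarrow>
   (nat \<Rightarrow> 'm \<Rightarrow> real ^ 'n) \<Rightarrow> (nat \<Rightarrow> 'm \<Rightarrow> real ^ 'n) \<Rightarrow> bool" where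
  "iceadmm w f \<sigma> H k0 x y X P \<longleftrightarrow>
     (\<forall>k.
        (k0 dvd k \<longrightarrow>
           x (k + 1) = (\<Sum>i\<in>UNIV. (\<sigma> i / (\<Sum>l\<in>UNIV. \<sigma> l)) *\<^sub>R X k i)
                     + (1 / (\<Sum>l\<in>UNIV. \<sigma> l)) *\<^sub>R (\<Sum>i\<in>UNIV. P k i)) \<and>
        y (k + 1) = x (tau k0 k + 1) \<and>
        (\<forall>i. X (k + 1) i =
               X k i - matrix_inv (w i *\<^sub>R H i + \<sigma> i *\<^sub>R mat 1) *v
                 (\<sigma> i *\<^sub>R (X k i - y (k + 1)) + w i *\<^sub>R grad (f i) (X k i) + P k i)) \<and>
        (\<forall>i. P (k + 1) i = P k i + \<sigma> i *\<^sub>R (X (k + 1) i - y (k + 1))))"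

definition aug_lagrangian ::
  "('m::finite \<Rightarrow> real) \<Rightarrow> ('m \<Rightarrow> real ^ 'n \<Rightarrow> real) \<Rightarrow> ('m \<Rightarrow> real) \<Rightarrow>
   real ^ 'n \<Rightarrow> ('m \<Rightarrow> real ^ 'n) \<Rightarrow> ('m \<Rightarrow> real ^ 'n) \<Rightarrow> real" where
  "aug_lagrangian w f \<sigma> y X P =
     (\<Sum>i\<in>UNIV. w i * f i (X i) + (X i - y) \<bullet> P i + \<sigma> i / 2 * (norm (X i - y))\<^sup>2)"

text \<open>\<open>\<phi>\<^sup>k\<close>, meaningful for \<open>k \<ge> 1\<close> only.\<close>

definition potential ::
  "('m::finite \<Rightarrow> real) \<Rightarrow> ('m \<Rightarrow> real ^ 'n \<Rightarrow> real) \<Rightarrow> ('m \<Rightarrow> real) \<Rightarrow> ('m \<Rightarrow> real) \<Rightarrow>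
   (nat \<Rightarrow> real ^ 'n) \<Rightarrow> (nat \<Rightarrow> 'm \<Rightarrow> real ^ 'n) \<Rightarrow> (nat \<Rightarrow> 'm \<Rightarrow> real ^ 'n) \<Rightarrow> nat \<Rightarrow> real" where
  "potential w f r \<sigma> y X P k =
     aug_lagrangian w f \<sigma> (y k) (X k) (P k)
     + (\<Sum>i\<in>UNIV. 6 * (w i)\<^sup>2 * (r i)\<^sup>2 / \<sigma> i * (norm (X k i - X (k - 1) i))\<^sup>2)"

definition vartheta ::
  "('m \<Rightarrow> real) \<Rightarrow> ('m \<Rightarrow> real) \<Rightarrow> ('m \<Rightarrow> real) \<Rightarrow> 'm \<Rightarrow> real" where
  "vartheta w r \<sigma> i = \<sigma> i - 18 * (w i)\<^sup>2 * (r i)\<^sup>2 / \<sigma> i"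

definition varrho ::
  "('m::finite \<Rightarrow> real) \<Rightarrow> ('m \<Rightarrow> real) \<Rightarrow> ('m \<Rightarrow> real) \<Rightarrow> real" where
  "varrho w r \<sigma> = (MAX i\<in>UNIV. 12 * real CARD('m) * (\<sigma> i)\<^sup>2 / vartheta w r \<sigma> i)"

end

theory Submission
  imports Defs
begin

text \<open>
  The potential \<open>\<phi>\<close> decreases at every step and never drops below \<open>f\<^sup>*\<close>. Right after a
  communication round, that is for \<open>\<tau> \<ge> 1\<close> divisible by \<open>k\<^sub>0\<close>, the averaging step gives
  \<open>\<Sum>\<^sub>i \<pi>\<^sub>i\<^sup>\<tau>\<^sup>+\<^sup>1 = \<Sum>\<^sub>i \<sigma>\<^sub>i (x\<^sub>i\<^sup>\<tau>\<^sup>+\<^sup>1 - x\<^sub>i\<^sup>\<tau>)\<close>, so that both squared gradients at time \<open>\<tau> + 1\<close> are bounded by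
  \<open>\<varrho> (\<phi>\<^sup>\<tau> - \<phi>\<^sup>\<tau>\<^sup>+\<^sup>1)\<close>. Among \<open>j + k\<^sub>0\<close> with \<open>1 \<le> j \<le> k\<close> there are at least \<open>k / k\<^sub>0\<close> times
  of this form, and telescoping over them gives the claim.
\<close>

subsection \<open>Gradients\<close>

lemma GDERIV_unique:
  assumes "GDERIV g x :> D" "GDERIV g x :> E"
  shows "D = E"
proof -
  have "(\<lambda>h. h \<bullet> D) = (\<lambda>h. h \<bullet> E)"
    using assms unfolding gderiv_def by (rule has_derivative_unique)
  then have "(D - E) \<bullet> D = (D - E) \<bullet> E"
    by meson
  then show ?thesis
    by (metis inner_diff_right inner_eq_zero_iff right_minus_eq)
qed

lemma grad_eqI: "GDERIV g x :> D \<Longrightarrow> grad g x = D"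
  unfolding grad_def by (blast intro: the_equality GDERIV_unique)

lemma GDERIV_grad:
  fixes g :: "'a::euclidean_space \<Rightarrow> real"
  assumes "g differentiable at x"
  shows "GDERIV g x :> grad g x"
proof -
  obtain g' where g': "(g has_derivative g') (at x)"
    using assms unfolding differentiable_def by blast
  then have "linear g'"
    by (rule has_derivative_linear)
  \<comment> \<open>Riesz representation: the adjoint of a linear functional, applied to 1, is its
    representing vector.\<close>
  then have "g' = (\<lambda>h. h \<bullet> adjoint g' 1)"
    by (simp add: adjoint_works fun_eq_iff)
  with g' have "GDERIV g x :> adjoint g' 1"
    unfolding gderiv_def by metis
  then show ?thesis
    by (simp add: grad_eqI)
qed

lemma grad_objective:
  assumes "\<And>i. f i differentiable at x"
  shows "grad (objective w f) x = (\<Sum>i\<in>UNIV. w i *\<^sub>R grad (f i) x)"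
proof (rule grad_eqI)
  have "(f i has_derivative (\<lambda>h. h \<bullet> grad (f i) x)) (at x)" for i
    using GDERIV_grad[OF assms] unfolding gderiv_def .
  then have "((\<lambda>x. \<Sum>i\<in>UNIV. w i * f i x) has_derivative
      (\<lambda>h. \<Sum>i\<in>UNIV. w i * (h \<bullet> grad (f i) x))) (at x)"
    by (intro has_derivative_sum has_derivative_mult_right)
  then show "GDERIV (objective w f) x :> (\<Sum>i\<in>UNIV. w i *\<^sub>R grad (f i) x)"
    unfolding gderiv_def objective_def[abs_def] by (simp add: inner_sum_right)
qed

subsection \<open>Positive semidefinite matrices\<close>

lemma psd_le_scalar_quadratic:
  fixes A :: "real ^ 'n ^ 'n"
  assumes "loewner_le A (r *\<^sub>R mat 1)"
  shows "(A *v v) \<bullet> v \<le> r * (norm v)\<^sup>2"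
proof -
  have "0 \<le> ((r *\<^sub>R mat 1 - A) *v v) \<bullet> v"
    using assms unfolding loewner_le_def psd_def by blast
  then show ?thesis
    by (simp add: matrix_vector_mult_diff_rdistrib inner_diff_left power2_norm_eq_inner
        scaleR_matrix_vector_assoc[symmetric])
qed

text \<open>The semidefinite order only constrains the quadratic form. The multiplier estimates need
  an operator norm bound, obtained here without diagonalising \<open>A\<close>.\<close>

lemma norm_psd_mult_le:
  fixes A :: "real ^ 'n ^ 'n"
  assumes "psd A" "loewner_le A (r *\<^sub>R mat 1)" "r > 0"
  shows "norm (A *v v) \<le> r * norm v"
proof -
  define u where "u = A *v v"
  have sym: "(A *v u) \<bullet> v = u \<bullet> u"
    using assms(1) unfolding psd_def u_def
    by (metis dot_lmul_matrix inner_commute transpose_matrix_vector)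
  \<comment> \<open>Expanding the quadratic form at \<open>v - u / r\<close> yields \<open>A\<^sup>2 \<le> r A\<close>.\<close>
  have "0 \<le> (A *v (v - (1/r) *\<^sub>R u)) \<bullet> (v - (1/r) *\<^sub>R u)"
    using assms(1) unfolding psd_def by blast
  also have "\<dots> = (A *v v) \<bullet> v - 2 / r * (norm u)\<^sup>2 + 1 / r\<^sup>2 * ((A *v u) \<bullet> u)"
    unfolding power2_norm_eq_inner
    by (simp add: matrix_vector_mult_diff_distrib matrix_vector_mult_scaleR inner_diff_left
        inner_diff_right sym u_def[symmetric] power2_eq_square diff_divide_distrib)
  also have "\<dots> \<le> r * (norm v)\<^sup>2 - 2 / r * (norm u)\<^sup>2 + 1 / r\<^sup>2 * (r * (norm u)\<^sup>2)"
    using psd_le_scalar_quadratic[OF assms(2)]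
    by (intro add_mono diff_mono mult_left_mono order_refl) auto
  also have "\<dots> = ((r * norm v)\<^sup>2 - (norm u)\<^sup>2) / r"
    using assms(3) by (simp add: field_simps power2_eq_square)
  finally have "(norm u)\<^sup>2 \<le> (r * norm v)\<^sup>2"
    using assms(3) by (simp add: zero_le_divide_iff)
  then show ?thesis
    unfolding u_def using assms(3) by (auto intro: power2_le_imp_le)
qed

text \<open>The shift makes \<open>B\<close> positive definite, so its kernel is trivial.
  Invertibility must come first because \<open>matrix_inv\<close> is defined by a choice.\<close>

lemma psd_shift_mult_matrix_inv:
  fixes A :: "real ^ 'n ^ 'n"
  assumes "psd A" "c \<ge> 0" "s > 0"
  defines "B \<equiv> c *\<^sub>R A + s *\<^sub>R mat 1"
  shows "B *v (matrix_inv B *v v) = v"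
proof -
  have B: "B *v u = c *\<^sub>R (A *v u) + s *\<^sub>R u" for u
    by (simp add: B_def matrix_vector_mult_add_rdistrib scaleR_matrix_vector_assoc[symmetric])
  have "u = 0" if "B *v u = 0" for u
  proof -
    have "c * ((A *v u) \<bullet> u) + s * (u \<bullet> u) = (B *v u) \<bullet> u"
      by (simp add: B inner_add_left)
    moreover have "0 \<le> c * ((A *v u) \<bullet> u)"
      using assms(1,2) by (simp add: psd_def)
    ultimately have "s * (u \<bullet> u) \<le> 0"
      using that by simp
    then have "u \<bullet> u \<le> 0"
      using assms(3) by (simp add: mult_le_0_iff)
    then show ?thesis
      using inner_gt_zero_iff[of u] by linarith
  qed
  then have "invertible B"
    by (simp add: invertible_left_inverse matrix_left_invertible_ker)
  then have "B ** matrix_inv B = mat 1"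
    unfolding invertible_def matrix_inv_def by (metis (mono_tags, lifting) someI_ex)
  then show ?thesis
    by (simp add: matrix_vector_mul_assoc)
qed

subsection \<open>Runs of the algorithm\<close>

locale iceadmm_run =
  fixes f :: "'m::finite \<Rightarrow> real ^ 'n \<Rightarrow> real"
    and w r \<sigma> :: "'m \<Rightarrow> real"
    and \<Theta> :: "'m \<Rightarrow> real ^ 'n ^ 'n"
    and x y :: "nat \<Rightarrow> real ^ 'n"
    and X P :: "nat \<Rightarrow> 'm \<Rightarrow> real ^ 'n"
    and k0 :: nat
  assumes w_pos: "w i > 0"
    and r_pos: "r i > 0"
    and f_lipschitz: "gradient_lipschitz (r i) (f i)"
    and Theta: "upper_curvature_matrix (r i) (f i) (\<Theta> i)"
    and sigma_pos: "\<sigma> i > 0"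
    and sigma_large: "\<sigma> i > 3 * sqrt 2 * w i * r i"
    and k0_pos: "k0 > 0"
    and algorithm: "iceadmm w f \<sigma> \<Theta> k0 x y X P"
begin

text \<open>A forward difference, whereas \<open>potential\<close> uses a backward one:
  \<open>\<phi> (Suc k)\<close> contains \<open>step k\<close>.\<close>

definition step :: "nat \<Rightarrow> 'm \<Rightarrow> real ^ 'n" where
  "step k i = X (Suc k) i - X k i"

abbreviation \<theta> :: "'m \<Rightarrow> real" where
  "\<theta> \<equiv> vartheta w r \<sigma>"

abbreviation \<phi> :: "nat \<Rightarrow> real" where
  "\<phi> \<equiv> potential w f r \<sigma> y X P"

text \<open>After division by \<open>\<sigma> i\<close> the later estimates become polynomial
  inequalities in the single ratio \<open>a i\<close>, which the choice of \<open>\<sigma> i\<close>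
  keeps below 1 / (3 sqrt 2).\<close>

lemma ratio_bounds:
  defines "a \<equiv> \<lambda>i. w i * r i / \<sigma> i"
  shows "a i > 0" "18 * (a i)\<^sup>2 < 1" "a i < 6 / 25"
proof -
  show a0: "a i > 0"
    using w_pos r_pos sigma_pos by (simp add: a_def)
  have "3 * sqrt 2 * a i < 1"
    using sigma_large[of i] sigma_pos[of i] by (simp add: a_def field_simps)
  then have "(3 * sqrt 2 * a i)\<^sup>2 < 1\<^sup>2"
    using a0 by (intro power_strict_mono) auto
  then show a1: "18 * (a i)\<^sup>2 < 1"
    by (simp add: power_mult_distrib)
  \<comment> \<open>A rational replacement for 1 / (3 sqrt 2): the square of 6/25 slightly exceeds
    1/18.\<close>
  have "(a i)\<^sup>2 < (6 / 25)\<^sup>2"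
    using a1 by (simp add: power2_eq_square)
  then show "a i < 6 / 25"
    by (rule power2_less_imp_less) simp
qed

lemma vartheta_eq: "\<theta> i = \<sigma> i * (1 - 18 * (w i * r i / \<sigma> i)\<^sup>2)"
  using sigma_pos[of i] by (simp add: vartheta_def field_simps power2_eq_square)

lemma vartheta_pos: "\<theta> i > 0"
  using ratio_bounds(2)[of i] sigma_pos[of i] by (simp add: vartheta_eq)

lemma vartheta_le: "\<theta> i \<le> \<sigma> i"
  using sigma_pos[of i] by (simp add: vartheta_def)

lemma psd_Theta: "psd (\<Theta> i)"
  using Theta[of i] by (simp add: upper_curvature_matrix_def loewner_le_def)

lemma Theta_nonneg: "0 \<le> (\<Theta> i *v v) \<bullet> v"
  using psd_Theta by (simp add: psd_def)

lemma Theta_le: "loewner_le (\<Theta> i) (r i *\<^sub>R mat 1)"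
  using Theta[of i] by (simp add: upper_curvature_matrix_def)

lemma norm_Theta_mult_le: "norm (\<Theta> i *v v) \<le> r i * norm v"
  by (rule norm_psd_mult_le[OF psd_Theta Theta_le r_pos])

lemma descent:
  "f i u \<le> f i v + grad (f i) v \<bullet> (u - v) + 1 / 2 * ((\<Theta> i *v (u - v)) \<bullet> (u - v))"
  using Theta[of i] unfolding upper_curvature_matrix_def by blast

lemma norm_grad_diff_le: "norm (w i *\<^sub>R (grad (f i) u - grad (f i) v)) \<le> w i * r i * norm (u - v)"
  using f_lipschitz[of i] w_pos[of i] by (simp add: gradient_lipschitz_def mult_left_mono)

section \<open>Multiplier identities\<close>

lemma P_Suc: "P (Suc k) i = P k i + \<sigma> i *\<^sub>R (X (Suc k) i - y (Suc k))"
  using algorithm unfolding iceadmm_def by simp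

lemma X_Suc:
  "X (Suc k) i = X k i - matrix_inv (w i *\<^sub>R \<Theta> i + \<sigma> i *\<^sub>R mat 1) *v
     (\<sigma> i *\<^sub>R (X k i - y (Suc k)) + w i *\<^sub>R grad (f i) (X k i) + P k i)"
  using algorithm unfolding iceadmm_def by simp

text \<open>Multiplying the update of \<open>X\<close> by its matrix gives the optimality condition
  of the local subproblem; the multiplier update absorbs every term carrying
  \<open>\<sigma> i\<close>. The initial multipliers are arbitrary, so this starts at index
  1.\<close>

lemma multiplier_eq:
  "P (Suc k) i = - (w i *\<^sub>R grad (f i) (X k i)) - w i *\<^sub>R (\<Theta> i *v step k i)"
proof -
  define B where "B = w i *\<^sub>R \<Theta> i + \<sigma> i *\<^sub>R mat 1"
  define v where "v = \<sigma> i *\<^sub>R (X k i - y (Suc k)) + w i *\<^sub>R grad (f i) (X k i) + P k i"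
  have "step k i = - (matrix_inv B *v v)"
    using X_Suc[of k i] by (simp add: step_def B_def v_def)
  moreover have "B *v (matrix_inv B *v v) = v"
    unfolding B_def using psd_shift_mult_matrix_inv psd_Theta w_pos sigma_pos less_imp_le by blast
  ultimately have "B *v step k i = - v"
    by (simp add: linear_neg[OF matrix_vector_mul_linear])
  moreover have "B *v step k i = w i *\<^sub>R (\<Theta> i *v step k i) + \<sigma> i *\<^sub>R step k i"
    by (simp add: B_def matrix_vector_mult_add_rdistrib scaleR_matrix_vector_assoc[symmetric])
  ultimately have "w i *\<^sub>R (\<Theta> i *v step k i) + \<sigma> i *\<^sub>R step k i + v = 0"
    by simp
  then show ?thesis
    unfolding v_def P_Suc by (simp add: step_def algebra_simps add_eq_0_iff)
qed

text \<open>Subtract two instances of \<open>multiplier_eq\<close>. The earlier step counts twice,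
  once through the gradient difference and once through its own \<open>\<Theta>\<close>
  term.\<close>

lemma norm_multiplier_diff_le:
  "norm (P (Suc (Suc k)) i - P (Suc k) i)
     \<le> w i * r i * (norm (step (Suc k) i) + 2 * norm (step k i))"
proof -
  have triangle: "norm (- a - b + c) \<le> norm a + norm b + norm c" for a b c :: "real ^ 'n"
    by norm
  have "P (Suc (Suc k)) i - P (Suc k) i =
      - (w i *\<^sub>R (grad (f i) (X (Suc k) i) - grad (f i) (X k i)))
      - w i *\<^sub>R (\<Theta> i *v step (Suc k) i) + w i *\<^sub>R (\<Theta> i *v step k i)"
    unfolding multiplier_eq by (simp add: algebra_simps)
  also have "norm \<dots> \<le> norm (w i *\<^sub>R (grad (f i) (X (Suc k) i) - grad (f i) (X k i)))
      + norm (w i *\<^sub>R (\<Theta> i *v step (Suc k) i)) + norm (w i *\<^sub>R (\<Theta> i *v step k i))"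
    by (rule triangle)
  also have "\<dots> \<le> w i * r i * norm (step k i) + w i * (r i * norm (step (Suc k) i))
      + w i * (r i * norm (step k i))"
    using norm_grad_diff_le[of i "X (Suc k) i" "X k i"] norm_Theta_mult_le[of i] w_pos[of i]
    by (intro add_mono) (simp_all add: step_def mult_left_mono)
  finally show ?thesis
    by (simp add: algebra_simps)
qed

subsection \<open>The potential\<close>

text \<open>The averaged point is the stationary point in \<open>y\<close> of the augmented
  Lagrangian, and this sum is its negative gradient there.\<close>

lemma average_balance:
  assumes "k0 dvd k"
  shows "(\<Sum>i\<in>UNIV. \<sigma> i *\<^sub>R (X k i - y (Suc k)) + P k i) = 0"
proof -
  define S where "S = (\<Sum>i\<in>UNIV. \<sigma> i)"
  have S: "S > 0"
    unfolding S_def by (intro sum_pos) (auto simp: sigma_pos)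
  have "y (Suc k) = x (Suc k)"
    using algorithm assms unfolding iceadmm_def tau_def by simp
  also have "\<dots> = (\<Sum>i\<in>UNIV. (\<sigma> i / S) *\<^sub>R X k i) + (1 / S) *\<^sub>R (\<Sum>i\<in>UNIV. P k i)"
    using algorithm assms unfolding iceadmm_def S_def by simp
  finally have "S *\<^sub>R y (Suc k) = (\<Sum>i\<in>UNIV. \<sigma> i *\<^sub>R X k i) + (\<Sum>i\<in>UNIV. P k i)"
    using S by (simp add: scaleR_add_right scaleR_sum_right)
  then show ?thesis
    by (simp add: scaleR_diff_right sum.distrib sum_subtractf scaleR_sum_left[symmetric] S_def)
qed

lemma y_Suc_eq:
  assumes "\<not> k0 dvd Suc k"
  shows "y (Suc (Suc k)) = y (Suc k)"
proof -
  have "Suc k div k0 = k div k0"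
    using assms by (simp add: div_Suc mod_eq_0_iff_dvd[symmetric] split: if_splits)
  then show ?thesis
    using algorithm unfolding iceadmm_def tau_def by simp
qed

lemma aug_lagrangian_y_update:
  "aug_lagrangian w f \<sigma> (y (Suc (Suc k))) (X (Suc k)) (P (Suc k))
     \<le> aug_lagrangian w f \<sigma> (y (Suc k)) (X (Suc k)) (P (Suc k))"
proof (cases "k0 dvd Suc k")
  case True
  define y1 where "y1 = y (Suc k)"
  define y2 where "y2 = y (Suc (Suc k))"
  \<comment> \<open>Exact expansion about \<open>y2\<close>: the linear coefficients sum to the
    expression in \<open>average_balance\<close>, leaving only nonnegative squares.\<close>
  have eq: "(c + (u - y1) \<bullet> p + s / 2 * (norm (u - y1))\<^sup>2)
        - (c + (u - y2) \<bullet> p + s / 2 * (norm (u - y2))\<^sup>2)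
      = (y2 - y1) \<bullet> (s *\<^sub>R (u - y2) + p) + s / 2 * (norm (y2 - y1))\<^sup>2"
    for u p and c s :: real
    unfolding power2_norm_eq_inner by (simp add: inner_diff inner_add inner_commute algebra_simps)
  have "aug_lagrangian w f \<sigma> y1 (X (Suc k)) (P (Suc k)) - aug_lagrangian w f \<sigma> y2 (X (Suc k)) (P (Suc k))
      = (y2 - y1) \<bullet> (\<Sum>i\<in>UNIV. \<sigma> i *\<^sub>R (X (Suc k) i - y2) + P (Suc k) i)
        + (\<Sum>i\<in>UNIV. \<sigma> i / 2 * (norm (y2 - y1))\<^sup>2)"
    unfolding aug_lagrangian_def sum_subtractf[symmetric] eq by (simp only: sum.distrib[symmetric] inner_sum_right)
  moreover have "(\<Sum>i\<in>UNIV. \<sigma> i *\<^sub>R (X (Suc k) i - y2) + P (Suc k) i) = 0"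
    using average_balance[OF True] unfolding y2_def .
  moreover have "0 \<le> (\<Sum>i\<in>UNIV. \<sigma> i / 2 * (norm (y2 - y1))\<^sup>2)"
    using sigma_pos by (intro sum_nonneg) (simp add: less_imp_le)
  ultimately show ?thesis
    unfolding y1_def[symmetric] y2_def[symmetric] by simp
next
  case False
  then show ?thesis
    by (simp add: y_Suc_eq)
qed

lemma aug_lagrangian_X_P_update:
  "w i * f i (X (Suc k) i) + (X (Suc k) i - y (Suc k)) \<bullet> P (Suc k) i
      + \<sigma> i / 2 * (norm (X (Suc k) i - y (Suc k)))\<^sup>2
   \<le> w i * f i (X k i) + (X k i - y (Suc k)) \<bullet> P k i + \<sigma> i / 2 * (norm (X k i - y (Suc k)))\<^sup>2
      - \<sigma> i / 2 * (norm (step k i))\<^sup>2 + (norm (P (Suc k) i - P k i))\<^sup>2 / \<sigma> i"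
proof -
  define u v d p q where "u = X k i - y (Suc k)" and "v = X (Suc k) i - y (Suc k)"
    and "d = step k i" and "p = P k i" and "q = P (Suc k) i"
  define g where "g = w i *\<^sub>R grad (f i) (X k i)"
  have v: "v = u + d"
    by (simp add: u_def v_def d_def step_def)
  have q: "q = p + \<sigma> i *\<^sub>R v"
    using P_Suc by (simp add: p_def q_def v_def)
  have g: "g = - q - w i *\<^sub>R (\<Theta> i *v d)"
    using multiplier_eq[of k i] by (simp add: g_def q_def d_def)
  have "w i * f i (X (Suc k) i)
      \<le> w i * (f i (X k i) + grad (f i) (X k i) \<bullet> d + 1 / 2 * ((\<Theta> i *v d) \<bullet> d))"
    using descent[of i "X (Suc k) i" "X k i"] w_pos[of i] unfolding d_def step_def
    by (intro mult_left_mono) auto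
  also have "\<dots> = w i * f i (X k i) + g \<bullet> d + w i / 2 * ((\<Theta> i *v d) \<bullet> d)"
    by (simp add: g_def algebra_simps)
  \<comment> \<open>Since the update uses the same matrix as the descent inequality, substituting
    \<open>g\<close> turns the curvature term from plus one half into minus one half.\<close>
  also have "\<dots> = w i * f i (X k i) - q \<bullet> d - w i / 2 * ((\<Theta> i *v d) \<bullet> d)"
    by (simp add: g inner_diff_left algebra_simps)
  also have "\<dots> \<le> w i * f i (X k i) - q \<bullet> d"
    using Theta_nonneg[of i d] w_pos[of i] by simp
  finally have "w i * f i (X (Suc k) i) \<le> w i * f i (X k i) - q \<bullet> d" .
  \<comment> \<open>Here \<open>v \<bullet> q - q \<bullet> d\<close> is
    \<open>u \<bullet> q\<close>, and polarisation of the inner product of \<open>u\<close> and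
    \<open>v\<close> gives the squares. The excess in \<open>v\<close> is the price of the
    multiplier update.\<close>
  moreover have "v \<bullet> q + \<sigma> i / 2 * (norm v)\<^sup>2 - q \<bullet> d
      = u \<bullet> p + \<sigma> i / 2 * (norm u)\<^sup>2 - \<sigma> i / 2 * (norm d)\<^sup>2 + \<sigma> i * (norm v)\<^sup>2"
    unfolding q v power2_norm_eq_inner by (simp add: inner_add inner_commute algebra_simps)
  moreover have "\<sigma> i * (norm v)\<^sup>2 = (norm (q - p))\<^sup>2 / \<sigma> i"
    using sigma_pos[of i] by (simp add: q power_mult_distrib power2_eq_square)
  ultimately show ?thesis
    unfolding u_def[symmetric] v_def[symmetric] d_def[symmetric] p_def[symmetric] q_def[symmetric]
    by linarith
qed

text \<open>
  The last summand is the slack of \<open>(a + 2 b)\<^sup>2 \<le> 3 a\<^sup>2 + 6 b\<^sup>2\<close>. It controls the previous step,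
  which the bound on the gradient at \<open>y\<close> involves and which for \<open>k = 0\<close> no earlier decrease of
  \<open>\<phi>\<close> covers.
\<close>

lemma potential_decrease:
  "(\<Sum>i\<in>UNIV. \<theta> i / 2 * (norm (step (Suc k) i))\<^sup>2
      + 2 * (w i * r i)\<^sup>2 / \<sigma> i * (norm (step (Suc k) i) - norm (step k i))\<^sup>2)
   \<le> \<phi> (Suc k) - \<phi> (Suc (Suc k))"
proof -
  define L where "L = (\<lambda>z k i. w i * f i (X k i) + (X k i - z) \<bullet> P k i + \<sigma> i / 2 * (norm (X k i - z))\<^sup>2)"
  define c where "c = (\<lambda>i. (w i * r i)\<^sup>2 / \<sigma> i)"
  have decrease: "\<theta> i / 2 * (norm (step (Suc k) i))\<^sup>2
        + 2 * (w i * r i)\<^sup>2 / \<sigma> i * (norm (step (Suc k) i) - norm (step k i))\<^sup>2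
      \<le> (L (y (Suc (Suc k))) (Suc k) i + 6 * c i * (norm (step k i))\<^sup>2)
        - (L (y (Suc (Suc k))) (Suc (Suc k)) i + 6 * c i * (norm (step (Suc k) i))\<^sup>2)" for i
  proof -
    define a b where "a = norm (step (Suc k) i)" and "b = norm (step k i)"
    have "(norm (P (Suc (Suc k)) i - P (Suc k) i))\<^sup>2 / \<sigma> i \<le> (w i * r i * (a + 2 * b))\<^sup>2 / \<sigma> i"
      using norm_multiplier_diff_le[of k i] sigma_pos[of i] unfolding a_def b_def
      by (intro divide_right_mono power_mono) auto
    also have "\<dots> = c i * (3 * a\<^sup>2 + 6 * b\<^sup>2 - 2 * (a - b)\<^sup>2)"
      by (simp add: c_def power2_eq_square algebra_simps add_divide_distrib)
    finally have "L (y (Suc (Suc k))) (Suc (Suc k)) i \<le> L (y (Suc (Suc k))) (Suc k) i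
        - \<sigma> i / 2 * a\<^sup>2 + c i * (3 * a\<^sup>2 + 6 * b\<^sup>2 - 2 * (a - b)\<^sup>2)"
      using aug_lagrangian_X_P_update[of i "Suc k"] unfolding L_def a_def by linarith
    \<comment> \<open>The 9 is 3 + 6: 3 from the multiplier change, 6 for the correction term of the
      next potential. Doubled, it is the 18 in \<open>vartheta\<close>.\<close>
    moreover have "\<theta> i / 2 * a\<^sup>2 = \<sigma> i / 2 * a\<^sup>2 - 9 * c i * a\<^sup>2"
      by (simp add: vartheta_def c_def power_mult_distrib left_diff_distrib)
    moreover have "2 * (w i * r i)\<^sup>2 / \<sigma> i = 2 * c i"
      by (simp add: c_def)
    ultimately show ?thesis
      unfolding a_def[symmetric] b_def[symmetric] by (simp add: algebra_simps)
  qed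
  have aug: "aug_lagrangian w f \<sigma> z (X k) (P k) = (\<Sum>i\<in>UNIV. L z k i)" for z k
    by (simp add: aug_lagrangian_def L_def)
  have pot: "\<phi> (Suc k) = (\<Sum>i\<in>UNIV. L (y (Suc k)) (Suc k) i) + (\<Sum>i\<in>UNIV. 6 * c i * (norm (step k i))\<^sup>2)"
    for k
    by (simp add: potential_def aug c_def step_def power_mult_distrib mult.assoc)
  have "(\<Sum>i\<in>UNIV. \<theta> i / 2 * (norm (step (Suc k) i))\<^sup>2
      + 2 * (w i * r i)\<^sup>2 / \<sigma> i * (norm (step (Suc k) i) - norm (step k i))\<^sup>2)
    \<le> (\<Sum>i\<in>UNIV. (L (y (Suc (Suc k))) (Suc k) i + 6 * c i * (norm (step k i))\<^sup>2)
        - (L (y (Suc (Suc k))) (Suc (Suc k)) i + 6 * c i * (norm (step (Suc k) i))\<^sup>2))"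
    by (intro sum_mono decrease)
  \<comment> \<open>The sum compares both Lagrangians at the new \<open>y\<close>; the update of
    \<open>y\<close> supplies the remaining comparison.\<close>
  then show ?thesis
    using aug_lagrangian_y_update[of k] unfolding pot aug by (simp add: sum.distrib sum_subtractf)
qed

lemma potential_antimono:
  assumes "1 \<le> j" "j \<le> k"
  shows "\<phi> k \<le> \<phi> j"
  using assms(2,1)
proof (induction k rule: dec_induct)
  case (step k)
  then obtain l where l: "k = Suc l"
    by (cases k) auto
  have "0 \<le> \<phi> (Suc l) - \<phi> (Suc (Suc l))"
    using vartheta_pos sigma_pos by (intro order_trans[OF sum_nonneg potential_decrease]) (simp add: less_imp_le)
  with step l show ?case
    by simp
qed simp

text \<open>The descent inequality moves each \<open>f i\<close> from its local point to
  \<open>y\<close>. There \<open>- P\<close> replaces the weighted gradient up to an error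
  proportional to the last step, which the correction term of the potential pays for.\<close>

lemma objective_le_potential: "objective w f (y (Suc k)) \<le> \<phi> (Suc k)"
proof -
  have "w i * f i (y (Suc k)) \<le> w i * f i (X (Suc k) i) + (X (Suc k) i - y (Suc k)) \<bullet> P (Suc k) i
      + \<sigma> i / 2 * (norm (X (Suc k) i - y (Suc k)))\<^sup>2
      + 6 * (w i)\<^sup>2 * (r i)\<^sup>2 / \<sigma> i * (norm (step k i))\<^sup>2" for i
  proof -
    define u where "u = X (Suc k) i - y (Suc k)"
    define g where "g = w i *\<^sub>R grad (f i) (X (Suc k) i)"
    define a d e where "a = w i * r i / \<sigma> i" and "d = norm u" and "e = norm (step k i)"
    have wr: "w i * r i = \<sigma> i * a"
      using sigma_pos[of i] by (simp add: a_def)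
    have yX: "y (Suc k) - X (Suc k) i = - u"
      by (simp add: u_def)
    have "w i * f i (y (Suc k)) \<le> w i * (f i (X (Suc k) i) - grad (f i) (X (Suc k) i) \<bullet> u
        + 1 / 2 * (r i * d\<^sup>2))"
      using descent[of i "y (Suc k)" "X (Suc k) i"] psd_le_scalar_quadratic[OF Theta_le, of i "- u"] w_pos[of i]
      unfolding yX d_def by (intro mult_left_mono) auto
    also have "\<dots> = w i * f i (X (Suc k) i) - u \<bullet> g + \<sigma> i * a / 2 * d\<^sup>2"
      unfolding wr[symmetric] g_def by (simp add: inner_commute algebra_simps)
    finally have 1: "w i * f i (y (Suc k)) \<le> w i * f i (X (Suc k) i) - u \<bullet> g + \<sigma> i * a / 2 * d\<^sup>2" .
    have "g + P (Suc k) i = w i *\<^sub>R (grad (f i) (X (Suc k) i) - grad (f i) (X k i))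
        - w i *\<^sub>R (\<Theta> i *v step k i)"
      by (simp add: g_def multiplier_eq algebra_simps)
    also have "norm \<dots> \<le> norm (w i *\<^sub>R (grad (f i) (X (Suc k) i) - grad (f i) (X k i)))
        + norm (w i *\<^sub>R (\<Theta> i *v step k i))"
      by (rule norm_triangle_ineq4)
    also have "\<dots> \<le> w i * r i * e + w i * (r i * e)"
      using norm_grad_diff_le[of i "X (Suc k) i" "X k i"] norm_Theta_mult_le[of i "step k i"] w_pos[of i]
      unfolding e_def by (intro add_mono) (simp_all add: step_def mult_left_mono)
    also have "\<dots> = 2 * \<sigma> i * a * e"
      using wr by (simp add: algebra_simps)
    finally have "norm (g + P (Suc k) i) \<le> 2 * \<sigma> i * a * e" .
    then have "norm u * norm (g + P (Suc k) i) \<le> d * (2 * \<sigma> i * a * e)"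
      unfolding d_def by (intro mult_left_mono) auto
    then have 2: "- (u \<bullet> (g + P (Suc k) i)) \<le> d * (2 * \<sigma> i * a * e)"
      using Cauchy_Schwarz_ineq2[of u "g + P (Suc k) i"] by linarith
    \<comment> \<open>Completing the square with weight 1/6 produces exactly the cross term
      \<open>2 * a * d * e\<close> and the coefficient 6 of the potential.\<close>
    have "0 \<le> (1 / 3 - a / 2) * d\<^sup>2 + (1 / 6) * (d - 6 * a * e)\<^sup>2"
      using ratio_bounds[of i] unfolding a_def by (intro add_nonneg_nonneg mult_nonneg_nonneg) auto
    also have "\<dots> = d\<^sup>2 / 2 - a / 2 * d\<^sup>2 - 2 * a * d * e + 6 * a\<^sup>2 * e\<^sup>2"
      by (simp add: power2_eq_square field_simps)
    finally have "0 \<le> \<sigma> i * \<dots>"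
      using sigma_pos[of i] by simp
    moreover have "6 * (w i)\<^sup>2 * (r i)\<^sup>2 / \<sigma> i = 6 * \<sigma> i * a\<^sup>2"
      using sigma_pos[of i] by (simp add: a_def power2_eq_square)
    ultimately show ?thesis
      using 1 2 unfolding u_def[symmetric] d_def[symmetric] e_def[symmetric]
      by (simp add: inner_add_right algebra_simps)
  qed
  then show ?thesis
    unfolding objective_def potential_def aug_lagrangian_def sum.distrib[symmetric] step_def
    by (simp add: sum_mono)
qed

subsection \<open>Gradients after a communication round\<close>

text \<open>By \<open>average_balance\<close> the new multipliers sum to the weighted steps, and
  \<open>multiplier_eq\<close> exchanges them for gradients at \<open>X k\<close>. Leaving
  \<open>G\<close> free, at distance \<open>b\<close> from those gradients, serves both gradients of
  the claim.\<close>

lemma norm_sum_gradients_le: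
  assumes "k0 dvd k"
    and "\<And>i. norm (w i *\<^sub>R (G i - grad (f i) (X k i))) \<le> \<sigma> i * b i"
    and "\<And>i. 0 \<le> b i"
  shows "norm (\<Sum>i\<in>UNIV. w i *\<^sub>R G i)
     \<le> (\<Sum>i\<in>UNIV. \<sigma> i * (b i + (1 + w i * r i / \<sigma> i) * norm (step k i)))"
proof -
  have "(\<Sum>i\<in>UNIV. P (Suc k) i - \<sigma> i *\<^sub>R step k i)
      = (\<Sum>i\<in>UNIV. \<sigma> i *\<^sub>R (X k i - y (Suc k)) + P k i)"
    by (intro sum.cong refl) (simp add: P_Suc step_def algebra_simps)
  then have "(\<Sum>i\<in>UNIV. w i *\<^sub>R G i)
      = (\<Sum>i\<in>UNIV. w i *\<^sub>R G i) + (\<Sum>i\<in>UNIV. P (Suc k) i - \<sigma> i *\<^sub>R step k i)"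
    using average_balance[OF assms(1)] by simp
  also have "\<dots> = (\<Sum>i\<in>UNIV. w i *\<^sub>R (G i - grad (f i) (X k i))
      - w i *\<^sub>R (\<Theta> i *v step k i) - \<sigma> i *\<^sub>R step k i)"
    unfolding sum.distrib[symmetric] by (intro sum.cong refl) (simp add: multiplier_eq algebra_simps)
  also have "norm \<dots> \<le> (\<Sum>i\<in>UNIV. \<sigma> i * (b i + (1 + w i * r i / \<sigma> i) * norm (step k i)))"
  proof (rule sum_norm_le)
    fix i
    have triangle: "norm (a - b - c) \<le> norm a + norm b + norm c" for a b c :: "real ^ 'n"
      by norm
    have "norm (w i *\<^sub>R (G i - grad (f i) (X k i)) - w i *\<^sub>R (\<Theta> i *v step k i) - \<sigma> i *\<^sub>R step k i)
      \<le> norm (w i *\<^sub>R (G i - grad (f i) (X k i))) + norm (w i *\<^sub>R (\<Theta> i *v step k i))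
        + norm (\<sigma> i *\<^sub>R step k i)"
      by (rule triangle)
    also have "\<dots> \<le> \<sigma> i * b i + w i * (r i * norm (step k i)) + \<sigma> i * norm (step k i)"
      using assms(2)[of i] norm_Theta_mult_le[of i "step k i"] w_pos[of i] sigma_pos[of i]
      by (intro add_mono) (simp_all add: mult_left_mono)
    also have "\<dots> = \<sigma> i * (b i + (1 + w i * r i / \<sigma> i) * norm (step k i))"
      using sigma_pos[of i] by (simp add: field_simps)
    finally show "norm (w i *\<^sub>R (G i - grad (f i) (X k i)) - w i *\<^sub>R (\<Theta> i *v step k i) - \<sigma> i *\<^sub>R step k i)
      \<le> \<sigma> i * (b i + (1 + w i * r i / \<sigma> i) * norm (step k i))" .
  qed
  finally show ?thesis .
qed

lemma varrho_nonneg: "0 \<le> varrho w r \<sigma>"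
  unfolding varrho_def
proof (intro Max_ge_iff[THEN iffD2] bexI)
  show "0 \<le> 12 * real CARD('m) * (\<sigma> i)\<^sup>2 / \<theta> i" for i :: 'm
    using vartheta_pos[of i] by simp
qed auto

text \<open>The common last stage for both gradients: the part in \<open>e\<close> is split into
  \<open>d\<close> and \<open>e - d\<close>, the two quantities whose squares
  \<open>potential_decrease\<close> controls.\<close>

lemma gradient_bound_le_decrease:
  fixes k
  defines "a \<equiv> \<lambda>i. w i * r i / \<sigma> i" and "d \<equiv> \<lambda>i. norm (step (Suc k) i)"
    and "e \<equiv> \<lambda>i. norm (step k i)"
  assumes "norm v \<le> (\<Sum>i\<in>UNIV. \<sigma> i * ((1 + 2 * a i + (a i)\<^sup>2) * d i + 2 * (a i)\<^sup>2 * e i))"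
  shows "(norm v)\<^sup>2 \<le> varrho w r \<sigma> * (\<phi> (Suc k) - \<phi> (Suc (Suc k)))"
proof -
  define t where "t = (\<lambda>i. \<sigma> i * ((1 + 2 * a i + (a i)\<^sup>2) * d i + 2 * (a i)\<^sup>2 * e i))"
  define D where "D = (\<lambda>i. \<theta> i / 2 * (d i)\<^sup>2 + 2 * (w i * r i)\<^sup>2 / \<sigma> i * (d i - e i)\<^sup>2)"
  have D_nonneg: "0 \<le> D i" for i
    using vartheta_pos[of i] sigma_pos[of i] by (simp add: D_def)
  have bound: "real CARD('m) * (t i)\<^sup>2 \<le> varrho w r \<sigma> * D i" for i
  proof -
    define z where "z = e i - d i"
    define p where "p = 1 + 2 * a i + 3 * (a i)\<^sup>2"
    have a: "0 < a i" "18 * (a i)\<^sup>2 < 1" "a i < 6 / 25"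
      using ratio_bounds[of i] by (auto simp: a_def)
    \<comment> \<open>The bounds on \<open>a\<close> give p < 1 + 12/25 + 1/6 < 17/10, and twice the
      square of 17/10 is below 6.\<close>
    have "0 \<le> p" "p \<le> 17 / 10"
      using a by (auto simp: p_def)
    then have "p\<^sup>2 \<le> (17 / 10)\<^sup>2"
      by (intro power_mono) auto
    then have p: "2 * p\<^sup>2 \<le> 6"
      by (simp add: power2_eq_square)
    have "(p * d i + 2 * (a i)\<^sup>2 * z)\<^sup>2 \<le> 2 * p\<^sup>2 * (d i)\<^sup>2 + 8 * (a i)\<^sup>2 * (a i)\<^sup>2 * z\<^sup>2"
      using zero_le_power2[of "p * d i - 2 * (a i)\<^sup>2 * z"] by (simp add: power2_eq_square algebra_simps)
    \<comment> \<open>The coefficients 6 and 24 are 12 times the weights 1/2 and 2 in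
      \<open>D\<close>; this is the 12 in \<open>varrho\<close>.\<close>
    also have "\<dots> \<le> 6 * (d i)\<^sup>2 + 24 * (a i)\<^sup>2 * z\<^sup>2"
      using p a by (intro add_mono mult_right_mono) auto
    finally have "\<theta> i * (p * d i + 2 * (a i)\<^sup>2 * z)\<^sup>2 \<le> \<theta> i * (6 * (d i)\<^sup>2) + \<theta> i * (24 * (a i)\<^sup>2 * z\<^sup>2)"
      using vartheta_pos[of i] by (simp add: distrib_left[symmetric])
    also have "\<dots> \<le> \<theta> i * (6 * (d i)\<^sup>2) + \<sigma> i * (24 * (a i)\<^sup>2 * z\<^sup>2)"
      using vartheta_le[of i] by (intro add_mono mult_right_mono) auto
    also have "\<dots> = 12 * D i"
      using sigma_pos[of i] by (simp add: D_def a_def z_def power2_eq_square field_simps)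
    finally have "(p * d i + 2 * (a i)\<^sup>2 * z)\<^sup>2 \<le> 12 * D i / \<theta> i"
      using vartheta_pos[of i] by (simp add: pos_le_divide_eq mult.commute)
    then have "(\<sigma> i)\<^sup>2 * (p * d i + 2 * (a i)\<^sup>2 * z)\<^sup>2 \<le> (\<sigma> i)\<^sup>2 * (12 * D i / \<theta> i)"
      by (intro mult_left_mono) auto
    moreover have "t i = \<sigma> i * (p * d i + 2 * (a i)\<^sup>2 * z)"
      by (simp add: t_def p_def z_def algebra_simps)
    ultimately have "(t i)\<^sup>2 \<le> (\<sigma> i)\<^sup>2 * (12 * D i / \<theta> i)"
      by (simp only: power_mult_distrib)
    then have "real CARD('m) * (t i)\<^sup>2 \<le> real CARD('m) * ((\<sigma> i)\<^sup>2 * (12 * D i / \<theta> i))"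
      by (intro mult_left_mono) auto
    also have "\<dots> = 12 * real CARD('m) * (\<sigma> i)\<^sup>2 / \<theta> i * D i"
      by simp
    also have "\<dots> \<le> varrho w r \<sigma> * D i"
      unfolding varrho_def by (intro mult_right_mono Max_ge D_nonneg) auto
    finally show ?thesis .
  qed
  have "(norm v)\<^sup>2 \<le> (\<Sum>i\<in>UNIV. t i)\<^sup>2"
    using assms(4) unfolding t_def by (intro power_mono) auto
  \<comment> \<open>Cauchy-Schwarz over the blocks, the source of the factor m in
    \<open>varrho\<close>.\<close>
  also have "\<dots> \<le> real CARD('m) * (\<Sum>i\<in>UNIV. (t i)\<^sup>2)"
    using sum_squared_le_sum_of_squares[of t UNIV] by (simp add: mult.commute)
  also have "\<dots> \<le> (\<Sum>i\<in>UNIV. varrho w r \<sigma> * D i)"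
    unfolding sum_distrib_left by (intro sum_mono bound)
  also have "\<dots> = varrho w r \<sigma> * (\<Sum>i\<in>UNIV. D i)"
    by (simp add: sum_distrib_left)
  also have "\<dots> \<le> varrho w r \<sigma> * (\<phi> (Suc k) - \<phi> (Suc (Suc k)))"
    using potential_decrease[of k] varrho_nonneg unfolding D_def d_def e_def by (intro mult_left_mono)
  finally show ?thesis .
qed

lemma gradients_le_potential_decrease:
  assumes "k0 dvd k" "k \<ge> 1"
  shows "max ((norm (gradF w f (X (Suc k))))\<^sup>2) ((norm (grad (objective w f) (y (Suc k))))\<^sup>2)
    \<le> varrho w r \<sigma> * (\<phi> k - \<phi> (Suc k))"
proof -
  obtain l where k: "k = Suc l"
    using assms(2) by (cases k) auto
  define a where "a = (\<lambda>i. w i * r i / \<sigma> i)"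
  define d where "d = (\<lambda>i. norm (step (Suc l) i))"
  define e where "e = (\<lambda>i. norm (step l i))"
  have a: "0 < a i" for i
    using ratio_bounds[of i] by (simp add: a_def)
  have wr: "w i * r i = \<sigma> i * a i" for i
    using sigma_pos[of i] by (simp add: a_def)
  have de: "0 \<le> d i" "0 \<le> e i" for i
    by (simp_all add: d_def e_def)
  have gX: "norm (w i *\<^sub>R (grad (f i) (X (Suc k) i) - grad (f i) (X k i))) \<le> \<sigma> i * (a i * d i)" for i
    using norm_grad_diff_le[of i "X (Suc k) i" "X k i"]
    by (simp add: k d_def step_def wr mult.assoc)
  have gy: "norm (w i *\<^sub>R (grad (f i) (y (Suc k)) - grad (f i) (X k i)))
      \<le> \<sigma> i * (a i * (1 + a i) * d i + 2 * (a i)\<^sup>2 * e i)" for i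
  proof -
    \<comment> \<open>The distance to \<open>y\<close> is read off the multiplier change, which
      brings in the previous step \<open>e\<close>; hence the requirement
      \<open>k \<ge> 1\<close>.\<close>
    have "\<sigma> i * norm (X (Suc k) i - y (Suc k)) = norm (P (Suc k) i - P k i)"
      using sigma_pos[of i] by (simp add: P_Suc)
    also have "\<dots> \<le> \<sigma> i * (a i * (d i + 2 * e i))"
      using norm_multiplier_diff_le[of l i] by (simp add: k d_def e_def wr mult.assoc)
    finally have "norm (X (Suc k) i - y (Suc k)) \<le> a i * (d i + 2 * e i)"
      using sigma_pos[of i] by simp
    moreover have "norm (y (Suc k) - X k i) \<le> norm (X (Suc k) i - X k i) + norm (X (Suc k) i - y (Suc k))"
      by norm
    ultimately have "norm (y (Suc k) - X k i) \<le> d i + a i * (d i + 2 * e i)"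
      by (simp add: k d_def step_def)
    then have "\<sigma> i * a i * norm (y (Suc k) - X k i) \<le> \<sigma> i * a i * (d i + a i * (d i + 2 * e i))"
      using sigma_pos[of i] a[of i] by (intro mult_left_mono) auto
    then show ?thesis
      using norm_grad_diff_le[of i "y (Suc k)" "X k i"] unfolding wr
      by (simp add: power2_eq_square algebra_simps)
  qed
  have gy_nonneg: "0 \<le> a i * (1 + a i) * d i + 2 * (a i)\<^sup>2 * e i" for i
    using a[of i] de[of i] by simp
  have diff: "f i differentiable at v" for i v
    using f_lipschitz[of i] by (simp add: gradient_lipschitz_def)
  have "norm (gradF w f (X (Suc k))) \<le> (\<Sum>i\<in>UNIV. \<sigma> i * (a i * d i + (1 + a i) * d i))"
    using norm_sum_gradients_le[OF assms(1) gX mult_nonneg_nonneg[OF less_imp_le[OF a] de(1)]]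
    by (simp add: gradF_def a_def d_def k)
  \<comment> \<open>Enlarged to the bound for the gradient at \<open>y\<close>, so that one estimate
    covers both.\<close>
  also have "\<dots> \<le> (\<Sum>i\<in>UNIV. \<sigma> i * ((1 + 2 * a i + (a i)\<^sup>2) * d i + 2 * (a i)\<^sup>2 * e i))"
    using sigma_pos de by (intro sum_mono mult_left_mono) (simp_all add: algebra_simps less_imp_le)
  finally have 1: "norm (gradF w f (X (Suc k)))
      \<le> (\<Sum>i\<in>UNIV. \<sigma> i * ((1 + 2 * a i + (a i)\<^sup>2) * d i + 2 * (a i)\<^sup>2 * e i))" .
  have "norm (grad (objective w f) (y (Suc k)))
      \<le> (\<Sum>i\<in>UNIV. \<sigma> i * (a i * (1 + a i) * d i + 2 * (a i)\<^sup>2 * e i + (1 + a i) * d i))"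
    using norm_sum_gradients_le[OF assms(1) gy gy_nonneg]
    by (simp add: grad_objective[OF diff] a_def d_def k)
  also have "\<dots> = (\<Sum>i\<in>UNIV. \<sigma> i * ((1 + 2 * a i + (a i)\<^sup>2) * d i + 2 * (a i)\<^sup>2 * e i))"
    by (intro sum.cong refl) (simp add: power2_eq_square algebra_simps)
  finally have 2: "norm (grad (objective w f) (y (Suc k)))
      \<le> (\<Sum>i\<in>UNIV. \<sigma> i * ((1 + 2 * a i + (a i)\<^sup>2) * d i + 2 * (a i)\<^sup>2 * e i))" .
  show ?thesis
    using gradient_bound_le_decrease[OF 1[unfolded a_def d_def e_def]]
      gradient_bound_le_decrease[OF 2[unfolded a_def d_def e_def]] unfolding k by simp
qed

section \<open>Telescoping over communication rounds\<close>

lemma sum_potential_decrease_le: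
  "(\<Sum>l<N. \<phi> (k0 * Suc l) - \<phi> (Suc (k0 * Suc l))) \<le> \<phi> 1 - \<phi> (Suc (k0 * N))"
proof (induction N)
  case (Suc N)
  \<comment> \<open>Monotonicity bridges the local iterations between two rounds; the decreases
    there are discarded.\<close>
  have "\<phi> (k0 * Suc N) \<le> \<phi> (Suc (k0 * N))"
    using k0_pos by (intro potential_antimono) auto
  with Suc show ?case
    by simp
qed simp

end

theorem theorem4p3:
  fixes f :: "'m::finite \<Rightarrow> real ^ 'n \<Rightarrow> real"
    and w r \<sigma> :: "'m \<Rightarrow> real"
    and \<Theta> H :: "'m \<Rightarrow> real ^ 'n ^ 'n"
    and xstar :: "real ^ 'n"
    and x y :: "nat \<Rightarrow> real ^ 'n"
    and X P :: "nat \<Rightarrow> 'm \<Rightarrow> real ^ 'n"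
    and k0 k :: nat
  assumes w_pos: "\<And>i. w i > 0"
    and w_sum: "(\<Sum>i\<in>UNIV. w i) = 1"
    and f_bounded: "\<And>i. bdd_below (range (f i))"
    and xstar_min: "\<And>z. objective w f xstar \<le> objective w f z"
    and r_pos: "\<And>i. r i > 0"
    and f_lipschitz: "\<And>i. gradient_lipschitz (r i) (f i)"
    and Theta: "\<And>i. upper_curvature_matrix (r i) (f i) (\<Theta> i)"
    and H_Theta: "\<And>i. H i = \<Theta> i"
    and sigma_pos: "\<And>i. \<sigma> i > 0"
    and sigma_large: "\<And>i. \<sigma> i > 3 * sqrt 2 * w i * r i"
    and k0_pos: "k0 > 0"
    and algorithm: "iceadmm w f \<sigma> H k0 x y X P"
    and k_pos: "k \<ge> 1"
  shows "(MIN j\<in>{1..k}. max ((norm (gradF w f (X (j + k0))))\<^sup>2)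
                              ((norm (grad (objective w f) (y (j + k0))))\<^sup>2))
         \<le> varrho w r \<sigma> * real k0 / real k
             * (potential w f r \<sigma> y X P 1 - objective w f xstar)"
proof -
  have "H = \<Theta>"
    using H_Theta by blast
  then interpret iceadmm_run f w r \<sigma> \<Theta> x y X P k0
    using assms by unfold_locales auto
  define M where "M = (\<lambda>j. max ((norm (gradF w f (X (j + k0))))\<^sup>2)
    ((norm (grad (objective w f) (y (j + k0))))\<^sup>2))"
  define m where "m = (MIN j\<in>{1..k}. M j)"
  \<comment> \<open>This is k / k0 rounded up, the number of indices 1, 1 + k0, 1 + 2 k0, ... in
    \<open>{1..k}\<close>. The shift by \<open>k0\<close> sends \<open>Suc (k0 * l)\<close> to
    \<open>Suc (k0 * Suc l)\<close>, the time right after a round.\<close>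
  define N where "N = Suc ((k - 1) div k0)"
  have m_nonneg: "0 \<le> m"
    using k_pos by (auto simp: m_def M_def le_max_iff_disj)
  have m_le: "m \<le> varrho w r \<sigma> * (\<phi> (k0 * Suc l) - \<phi> (Suc (k0 * Suc l)))" if "l < N" for l
  proof -
    have "k0 * l \<le> k0 * ((k - 1) div k0)"
      using that by (simp add: N_def)
    also have "\<dots> \<le> k - 1"
      by simp
    finally have "Suc (k0 * l) \<in> {1..k}"
      using k_pos by auto
    then have "m \<le> M (Suc (k0 * l))"
      unfolding m_def by (intro Min_le) auto
    also have "\<dots> \<le> varrho w r \<sigma> * (\<phi> (k0 * Suc l) - \<phi> (Suc (k0 * Suc l)))"
      using gradients_le_potential_decrease[of "k0 * Suc l"] k0_pos by (simp add: M_def add.commute)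
    finally show ?thesis .
  qed
  have "k - 1 < k0 * N"
    unfolding N_def using k0_pos dividend_less_times_div by simp
  then have "real k \<le> real k0 * real N"
    using k_pos by (metis One_nat_def Suc_leI Suc_pred of_nat_le_iff of_nat_mult le_eq_less_or_eq less_le_trans zero_less_one)
  \<comment> \<open>Nonnegativity of \<open>m\<close> allows \<open>k\<close> to be replaced by the
    larger \<open>k0 * N\<close>.\<close>
  then have "m * real k \<le> real k0 * (\<Sum>l<N. m)"
    using mult_left_mono[OF _ m_nonneg, of "real k" "real k0 * real N"] by (simp add: algebra_simps)
  also have "\<dots> \<le> real k0 * (\<Sum>l<N. varrho w r \<sigma> * (\<phi> (k0 * Suc l) - \<phi> (Suc (k0 * Suc l))))"
    by (intro mult_left_mono sum_mono m_le) auto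
  also have "\<dots> = real k0 * (varrho w r \<sigma> * (\<Sum>l<N. \<phi> (k0 * Suc l) - \<phi> (Suc (k0 * Suc l))))"
    by (simp add: sum_distrib_left)
  \<comment> \<open>The final potential is at least the objective at the current \<open>y\<close>,
    hence at least the minimum.\<close>
  also have "\<dots> \<le> real k0 * (varrho w r \<sigma> * (\<phi> 1 - objective w f xstar))"
    using sum_potential_decrease_le[of N] objective_le_potential[of "k0 * N"] xstar_min[of "y (Suc (k0 * N))"]
    by (intro mult_left_mono varrho_nonneg) auto
  finally have "m \<le> varrho w r \<sigma> * real k0 / real k * (\<phi> 1 - objective w f xstar)"
    using k_pos by (simp add: pos_le_divide_eq mult_ac)
  then show ?thesis
    by (simp add: m_def M_def)
qed

end
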